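(* Let $H,V$ be complex Hilbert spaces and $j\colon V\to H$ a bounded linear operator such that $j(V)$ is dense in $H$. Let $a\colon V\times V\to\mathbf{C}$ be a continuous sesquilinear form which is $j$-elliptic. Then: (a) There exists an operator $A$ in $H$ such that for all $x,f\in H$ one has $x\in D(A)$ and $Ax=f$ if and only if there exists a $u\in V$ such that $j(u)=x$ and $a(u,v)=(f,j(v))_H$ for all $v\in V$. (b) The operator $A$ of statement (a) is $m$-sectorial.
   Context: Sesquilinear forms and inner products are linear in the first and conjugate-linear in the second variable; $a(u)=a(u,u)$; $\Sigma_\theta=\{re^{i\alpha}:r\ge0,\ |\alpha|\le\theta\}$. Operators are single-valued linear maps $A\colon D(A)\to H$ with $D(A)$ a linear subspace of $H$. The form $a$ is $j$-elliptic if there exist $\omega\in\mathbf{R}$ and $\mu>0$ such that $\operatorname{Re}a(u)+\omega\|j(u)\|_H^2\ge\mu\|u\|_V^2$ for all $u\in V$. The map $j$ is not assumed injective. An operator $A$ in $H$ is sectorial if there are $\gamma\in\mathbf{R}$ (a vertex) and $\theta\in[0,\frac\pi2)$ (a semi-angle) with $(Ax,x)_H-\gamma\|x\|_H^2\in\Sigma_\theta$ for all $x\in D(A)$; it is $m$-sectorial if it is sectorial and $\lambda I-A$ is surjective for some $\lambda\in\mathbf{R}$ with $\lambda<\gamma$. *)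

theory Defs
  imports "HOL-Analysis.Analysis"
begin

section \<open>Complex Hilbert spaces\<close>

class scaleC = scaleR +
  fixes scaleC :: "complex \<Rightarrow> 'a \<Rightarrow> 'a" (infixr "*\<^sub>C" 75)
  assumes scaleR_scaleC: "r *\<^sub>R x = complex_of_real r *\<^sub>C x"

class complex_vector = scaleC + real_vector +
  assumes scaleC_add_right: "c *\<^sub>C (x + y) = c *\<^sub>C x + c *\<^sub>C y"
    and scaleC_add_left: "(c + d) *\<^sub>C x = c *\<^sub>C x + d *\<^sub>C x"
    and scaleC_scaleC: "c *\<^sub>C d *\<^sub>C x = (c * d) *\<^sub>C x"
    and scaleC_one: "1 *\<^sub>C x = x"

global_interpretation complex_vector: vector_space "scaleC :: complex \<Rightarrow> 'a \<Rightarrow> 'a::complex_vector"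
  defines csubspace = complex_vector.subspace
  by unfold_locales (simp_all add: scaleC_add_right scaleC_add_left scaleC_scaleC scaleC_one)

text \<open>
  The complex inner product is linear in the first and conjugate-linear in the second argument.
  Its real part is the inner product of the underlying real space, so that norm, metric and
  topology, as well as positive definiteness, are those of the class \<^class>\<open>real_inner\<close>.
\<close>

class complex_inner = complex_vector + real_inner +
  fixes cinner :: "'a \<Rightarrow> 'a \<Rightarrow> complex"
  assumes cinner_commute: "cinner x y = cnj (cinner y x)"
    and cinner_add_left: "cinner (x + y) z = cinner x z + cinner y z"
    and cinner_scaleC_left: "cinner (c *\<^sub>C x) y = c * cinner x y"
    and inner_eq_Re_cinner: "inner x y = Re (cinner x y)"

class complex_hilbert = complex_inner + complete_space

instantiation complex :: complex_hilbert
begin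

definition scaleC_complex :: "complex \<Rightarrow> complex \<Rightarrow> complex" where
  "scaleC_complex c x = c * x"

definition cinner_complex :: "complex \<Rightarrow> complex \<Rightarrow> complex" where
  "cinner_complex x y = x * cnj y"

instance
  by standard
    (simp_all add: scaleC_complex_def cinner_complex_def scaleR_conv_of_real algebra_simps
      inner_complex_def)

end

lemma cinner_self: "cinner x x = complex_of_real ((norm x)\<^sup>2)"
  for x :: "'a::complex_inner"
proof (rule complex_eqI)
  show "Re (cinner x x) = Re (complex_of_real ((norm x)\<^sup>2))"
    by (simp add: power2_norm_eq_inner inner_eq_Re_cinner)
  have "Im (cinner x x) = - Im (cinner x x)"
    by (subst cinner_commute) simp
  then show "Im (cinner x x) = Im (complex_of_real ((norm x)\<^sup>2))"
    by simp
qed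

definition bounded_clinear :: "('a::complex_inner \<Rightarrow> 'b::complex_inner) \<Rightarrow> bool" where
  "bounded_clinear f \<longleftrightarrow> bounded_linear f \<and> Vector_Spaces.linear scaleC scaleC f"


section \<open>Sesquilinear forms\<close>

definition sesquilinear :: "('v::complex_vector \<Rightarrow> 'v \<Rightarrow> complex) \<Rightarrow> bool" where
  "sesquilinear a \<longleftrightarrow>
     (\<forall>u u' v. a (u + u') v = a u v + a u' v) \<and>
     (\<forall>c u v. a (c *\<^sub>C u) v = c * a u v) \<and>
     (\<forall>u v v'. a u (v + v') = a u v + a u v') \<and>
     (\<forall>c u v. a u (c *\<^sub>C v) = cnj c * a u v)"

definition j_elliptic ::
    "('v::complex_inner \<Rightarrow> 'h::complex_inner) \<Rightarrow> ('v \<Rightarrow> 'v \<Rightarrow> complex) \<Rightarrow> bool" where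
  "j_elliptic j a \<longleftrightarrow>
     (\<exists>\<omega>::real. \<exists>\<mu>>0. \<forall>u. Re (a u u) + \<omega> * (norm (j u))\<^sup>2 \<ge> \<mu> * (norm u)\<^sup>2)"


section \<open>Sectorial operators\<close>

text \<open>
  An operator in \<open>H\<close> is represented by a partial map: its domain \<open>D(A)\<close> is \<^term>\<open>dom A\<close>, and its
  value at \<open>x \<in> D(A)\<close> is \<^term>\<open>the (A x)\<close>.
\<close>

definition linear_operator :: "('h::complex_vector \<rightharpoonup> 'h) \<Rightarrow> bool" where
  "linear_operator A \<longleftrightarrow> csubspace (dom A) \<and>
     (\<forall>x\<in>dom A. \<forall>y\<in>dom A. the (A (x + y)) = the (A x) + the (A y)) \<and>
     (\<forall>c. \<forall>x\<in>dom A. the (A (c *\<^sub>C x)) = c *\<^sub>C the (A x))"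

definition sector :: "real \<Rightarrow> complex set" where
  "sector \<theta> = {complex_of_real r * exp (\<i> * complex_of_real \<alpha>) |r \<alpha>. 0 \<le> r \<and> \<bar>\<alpha>\<bar> \<le> \<theta>}"

definition sectorial_with :: "('h::complex_inner \<rightharpoonup> 'h) \<Rightarrow> real \<Rightarrow> real \<Rightarrow> bool" where
  "sectorial_with A \<gamma> \<theta> \<longleftrightarrow> 0 \<le> \<theta> \<and> \<theta> < pi / 2 \<and>
     (\<forall>x\<in>dom A. cinner (the (A x)) x - complex_of_real (\<gamma> * (norm x)\<^sup>2) \<in> sector \<theta>)"

definition m_sectorial :: "('h::complex_inner \<rightharpoonup> 'h) \<Rightarrow> bool" where
  "m_sectorial A \<longleftrightarrow> (\<exists>\<gamma> \<theta>. sectorial_with A \<gamma> \<theta> \<and>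
     (\<exists>\<nu><\<gamma>. (\<lambda>x. \<nu> *\<^sub>R x - the (A x)) ` dom A = UNIV))"

text \<open>
  \<open>A\<close> is the operator associated with \<open>(a, j)\<close>. As \<open>j\<close> need not be injective, there may be several
  \<open>u\<close> with \<open>j u = x\<close>.
\<close>

definition associated_operator ::
    "('v::complex_inner \<Rightarrow> 'v \<Rightarrow> complex) \<Rightarrow> ('v \<Rightarrow> 'h::complex_inner) \<Rightarrow> ('h \<rightharpoonup> 'h) \<Rightarrow> bool" where
  "associated_operator a j A \<longleftrightarrow> linear_operator A \<and>
     (\<forall>x f. x \<in> dom A \<and> the (A x) = f \<longleftrightarrow>
        (\<exists>u. j u = x \<and> (\<forall>v. a u v = cinner f (j v))))"

end

(*
  If j u = x and a(u, v) = (f, j v) for all v, then a(u, u) = (f, x), so the values of a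
  on the diagonal control the numerical range of the operator. With x = 0, ellipticity forces u = 0
  and density of the range of j forces f = 0, so the relation between x and f is the
  graph of an operator. The same identity together with |Im a(u, u)| <= M |u|^2 gives
  sectoriality with vertex -omega. For nu = -omega - 1 the form a(u, v) - nu (j u, j v) is coercive,
  and solving nu x - A x = g amounts to applying the Lax-Milgram lemma to it. That lemma is only
  needed for the real part of the form, since a sesquilinear form is determined by its real part.
*)

theory Submission
  imports Defs
begin

section \<open>The Lax--Milgram lemma in real Hilbert spaces\<close>

lemma norm_diff_sq:
  fixes x y :: "'a::real_inner"
  shows "(norm (x - y))\<^sup>2 = (norm x)\<^sup>2 - 2 * inner x y + (norm y)\<^sup>2"
  by (simp add: power2_norm_eq_inner inner_diff_left inner_diff_right inner_commute)

text \<open>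
  The representing vector is the minimiser of \<open>F x = \<parallel>x\<parallel>\<^sup>2 - 2 f x\<close>; the parallelogram law makes
  minimising sequences Cauchy.
\<close>

lemma riesz_representation:
  fixes f :: "'a::{real_inner, complete_space} \<Rightarrow> real"
  assumes "bounded_linear f"
  shows "\<exists>w. \<forall>v. f v = inner w v"
proof -
  interpret f: bounded_linear f by fact
  define F where "F x = (norm x)\<^sup>2 - 2 * f x" for x
  define m where "m = Inf (range F)"
  obtain K where K: "\<And>x. norm (f x) \<le> norm x * K"
    using f.bounded by blast
  \<comment> \<open>Since \<open>f x \<le> K * norm x\<close>, completing the square bounds
    \<open>F x\<close> below by \<open>(norm x - K)^2 - K^2\<close>.\<close>
  have "- K\<^sup>2 \<le> F x" for x
  proof -
    have "f x \<le> norm x * K"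
      using K[of x] by simp
    moreover have "0 \<le> (norm x - K)\<^sup>2"
      by simp
    ultimately show ?thesis
      unfolding F_def by (simp add: power2_diff)
  qed
  then have "bdd_below (range F)"
    by (meson bdd_belowI2)
  then have m_le: "m \<le> F x" for x
    unfolding m_def by (simp add: cInf_lower)
  have "\<exists>x. F x < m + inverse (real (Suc n))" for n
    using cInf_lessD[of "range F" "m + inverse (real (Suc n))"] unfolding m_def by auto
  then obtain X where X: "\<And>n. F (X n) < m + inverse (real (Suc n))"
    by metis
  have close: "(norm (x - y))\<^sup>2 < 4 * e" if "F x < m + e" "F y < m + e" for x y e
  proof -
    define z where "z = (1/2) *\<^sub>R (x + y)"
    have "4 * (norm z)\<^sup>2 = (norm (x + y))\<^sup>2" "2 * f z = f x + f y"
      unfolding z_def by (simp_all add: f.scaleR f.add power_divide)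
    moreover have "(norm (x - y))\<^sup>2 = 2 * (norm x)\<^sup>2 + 2 * (norm y)\<^sup>2 - (norm (x + y))\<^sup>2"
      by (simp add: power2_norm_eq_inner algebra_simps inner_commute)
    ultimately have "(norm (x - y))\<^sup>2 = 2 * F x + 2 * F y - 4 * F z"
      unfolding F_def by simp
    with that m_le[of z] show ?thesis
      by linarith
  qed
  have "Cauchy X"
  proof (rule metric_CauchyI)
    fix e :: real
    assume "0 < e"
    \<comment> \<open>The factor 4 in \<open>close\<close> turns an excess of \<open>e^2 / 4\<close>
      over \<open>m\<close> into a distance below \<open>e\<close>.\<close>
    then obtain N where N: "inverse (real (Suc N)) < e\<^sup>2 / 4"
      using reals_Archimedean[of "e\<^sup>2 / 4"] by auto
    have small: "F (X n) < m + e\<^sup>2 / 4" if "N \<le> n" for n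
    proof -
      have "inverse (real (Suc n)) \<le> inverse (real (Suc N))"
        using that by (intro le_imp_inverse_le) auto
      with X[of n] N show ?thesis by linarith
    qed
    have "dist (X k) (X n) < e" if "N \<le> k" "N \<le> n" for k n
    proof -
      have "(norm (X k - X n))\<^sup>2 < e\<^sup>2"
        using close[OF small[OF that(1)] small[OF that(2)]] by simp
      then show ?thesis
        using \<open>0 < e\<close> by (metis dist_norm less_imp_le power_less_imp_less_base)
    qed
    then show "\<exists>N. \<forall>k\<ge>N. \<forall>n\<ge>N. dist (X k) (X n) < e"
      by blast
  qed
  then obtain w where w: "X \<longlonglongrightarrow> w"
    using Cauchy_convergent convergent_def by blast
  have "(\<lambda>n. F (X n)) \<longlonglongrightarrow> F w"
    unfolding F_def by (intro tendsto_intros f.tendsto w)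
  moreover have "(\<lambda>n. m + inverse (real (Suc n))) \<longlonglongrightarrow> m + 0"
    by (intro tendsto_intros LIMSEQ_inverse_real_of_nat)
  ultimately have "F w \<le> m + 0"
    using X by (intro LIMSEQ_le) (auto intro: less_imp_le)
  have "f v = inner w v" for v
  proof (cases "v = 0")
    case False
    define d where "d = f v - inner w v"
    \<comment> \<open>This \<open>t\<close> minimises the quadratic
      \<open>F (w + t v) = F w - 2 t d + t^2 |v|^2\<close>. Its minimum is
      \<open>F w - d^2 / |v|^2\<close>, so minimality of \<open>F w\<close> forces
      \<open>d = 0\<close>.\<close>
    define t where "t = d / (norm v)\<^sup>2"
    have "(norm (w + t *\<^sub>R v))\<^sup>2 = (norm w)\<^sup>2 + 2 * t * inner w v + t\<^sup>2 * (norm v)\<^sup>2"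
      by (simp add: power2_norm_eq_inner inner_commute power2_eq_square[of t] algebra_simps)
    then have "F (w + t *\<^sub>R v) = F w - 2 * (t * d) + t\<^sup>2 * (norm v)\<^sup>2"
      unfolding F_def d_def by (simp add: f.scaleR f.add algebra_simps)
    moreover have "t\<^sup>2 * (norm v)\<^sup>2 = d\<^sup>2 / (norm v)\<^sup>2" "t * d = d\<^sup>2 / (norm v)\<^sup>2"
      using False unfolding t_def by (simp_all add: power2_eq_square)
    ultimately have "d\<^sup>2 / (norm v)\<^sup>2 \<le> 0"
      using m_le[of "w + t *\<^sub>R v"] \<open>F w \<le> m + 0\<close> by simp
    then have "d = 0"
      using False by (simp add: divide_le_0_iff)
    then show ?thesis
      unfolding d_def by simp
  qed simp
  then show ?thesis by blast
qed

text \<open>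
  With \<open>B u v = \<langle>T u, v\<rangle>\<close> and \<open>f v = \<langle>w, v\<rangle>\<close>, the solution of \<open>T u = w\<close> is the fixed point of
  \<open>u \<mapsto> u - \<rho> (T u - w)\<close>, which is a contraction for \<open>\<rho> = \<mu> / K\<^sup>2\<close>.
\<close>

lemma lax_milgram:
  fixes B :: "'a::{real_inner, complete_space} \<Rightarrow> 'a \<Rightarrow> real"
  assumes "bounded_bilinear B" and "0 < \<mu>" and coercive: "\<And>u. \<mu> * (norm u)\<^sup>2 \<le> B u u"
    and "bounded_linear f"
  shows "\<exists>u. \<forall>v. B u v = f v"
proof -
  interpret B: bounded_bilinear B by fact
  obtain w where w: "\<And>v. f v = inner w v"
    using riesz_representation[OF \<open>bounded_linear f\<close>] by blast
  obtain T where T: "\<And>u v. B u v = inner (T u) v"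
    using riesz_representation[OF B.bounded_linear_right] by metis
  obtain K0 where K0: "0 < K0" "\<And>u v. norm (B u v) \<le> norm u * norm v * K0"
    using B.pos_bounded by blast
  \<comment> \<open>Enlarging the bound by \<mu> gives \<open>\<mu> \<le> K\<close>, even on the
    zero space, so the radicand in \<open>c\<close> is nonnegative.\<close>
  define K where "K = K0 + \<mu>"
  have K: "0 < K" "\<mu> \<le> K"
    unfolding K_def using K0(1) \<open>0 < \<mu>\<close> by simp_all
  \<comment> \<open>The minimiser of \<open>1 - 2 \<rho> \<mu> + \<rho>^2 K^2\<close>, the factor by
    which \<open>S\<close> scales squared distances at most; the minimum is
    \<open>c^2\<close>.\<close>
  define \<rho> where "\<rho> = \<mu> / K\<^sup>2"
  define c where "c = sqrt (1 - \<mu>\<^sup>2 / K\<^sup>2)"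
  have \<rho>: "0 < \<rho>"
    unfolding \<rho>_def using K(1) \<open>0 < \<mu>\<close> by simp
  have ratio: "0 < \<mu>\<^sup>2 / K\<^sup>2" "\<mu>\<^sup>2 / K\<^sup>2 \<le> 1"
    using K \<open>0 < \<mu>\<close> by (simp_all add: power_mono)
  have c: "0 \<le> c" "c < 1" "c\<^sup>2 = 1 - \<mu>\<^sup>2 / K\<^sup>2"
    unfolding c_def using ratio by simp_all
  have T_diff: "inner (T x - T y) v = B (x - y) v" for x y v
    by (simp add: inner_diff_left B.diff_left flip: T)
  have T_lipschitz: "norm (T x - T y) \<le> K * norm (x - y)" for x y
  proof -
    have "(norm (T x - T y))\<^sup>2 = B (x - y) (T x - T y)"
      by (simp add: power2_norm_eq_inner T_diff)
    also have "\<dots> \<le> norm (x - y) * norm (T x - T y) * K0"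
      using K0(2)[of "x - y" "T x - T y"] by simp
    also have "\<dots> \<le> norm (x - y) * norm (T x - T y) * K"
      unfolding K_def using \<open>0 < \<mu>\<close> by (intro mult_left_mono) auto
    finally have "norm (T x - T y) * norm (T x - T y) \<le> (K * norm (x - y)) * norm (T x - T y)"
      by (simp add: power2_eq_square mult_ac)
    then show ?thesis
      using K(1) by (cases "T x = T y") simp_all
  qed
  define S where "S u = u - \<rho> *\<^sub>R (T u - w)" for u
  have "dist (S x) (S y) \<le> c * dist x y" for x y
  proof -
    have "S x - S y = (x - y) - \<rho> *\<^sub>R (T x - T y)"
      unfolding S_def by (simp add: algebra_simps)
    then have "(norm (S x - S y))\<^sup>2
        = (norm (x - y))\<^sup>2 - 2 * (\<rho> * B (x - y) (x - y)) + \<rho>\<^sup>2 * (norm (T x - T y))\<^sup>2"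
      by (simp add: norm_diff_sq[of "x - y"] inner_commute[of "x - y"] T_diff power_mult_distrib)
    also have "\<dots> \<le> (norm (x - y))\<^sup>2 - 2 * (\<rho> * (\<mu> * (norm (x - y))\<^sup>2))
        + \<rho>\<^sup>2 * (K * norm (x - y))\<^sup>2"
      using \<rho> coercive[of "x - y"] T_lipschitz[of x y]
      by (intro add_mono diff_mono mult_left_mono power_mono) auto
    also have "\<dots> = (1 - 2 * (\<rho> * \<mu>) + \<rho>\<^sup>2 * K\<^sup>2) * (norm (x - y))\<^sup>2"
      by (simp add: algebra_simps)
    also have "1 - 2 * (\<rho> * \<mu>) + \<rho>\<^sup>2 * K\<^sup>2 = c\<^sup>2"
      unfolding c(3) \<rho>_def using K(1) by (simp add: field_simps power2_eq_square)
    finally have "(norm (S x - S y))\<^sup>2 \<le> (c * norm (x - y))\<^sup>2"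
      by (simp add: power_mult_distrib)
    then show ?thesis
      unfolding dist_norm by (rule power2_le_imp_le) (simp add: c(1))
  qed
  then obtain u where "S u = u"
    using banach_fix_type[OF c(1,2), of S] by blast
  then have "T u = w"
    unfolding S_def using \<rho> by simp
  then show ?thesis
    using T w by metis
qed

section \<open>Sesquilinear forms\<close>

text \<open>Continuity at the origin bounds \<open>a\<close> on a small ball, and homogeneity in
  each variable spreads the bound. Only real scalars enter, so it serves both a complex form and its
  real part.\<close>

lemma continuous_bilinear_imp_bounded_bilinear:
  fixes a :: "'a::real_normed_vector \<Rightarrow> 'b::real_normed_vector \<Rightarrow> 'c::real_normed_vector"
  assumes left: "\<And>v. linear (\<lambda>u. a u v)" and right: "\<And>u. linear (a u)"
    and "continuous_on UNIV (\<lambda>(u, v). a u v)"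
  shows "bounded_bilinear a"
proof
  have zero: "a 0 0 = 0"
    by (rule linear_0[OF right])
  have "continuous (at (0, 0)) (\<lambda>(u, v). a u v)"
    using assms(3) by (simp add: continuous_on_eq_continuous_at)
  then obtain d where "0 < d"
    and d: "\<And>p. dist p (0, 0) < d \<Longrightarrow> dist (case p of (u, v) \<Rightarrow> a u v) (a 0 0) < 1"
    unfolding continuous_at_eps_delta by (metis case_prod_conv zero_less_one)
  have unit: "norm (a u v) \<le> 1" if "norm u < d / 2" "norm v < d / 2" for u v
  proof -
    have "dist (u, v) (0, 0) \<le> norm u + norm v"
      by (simp add: dist_norm norm_Pair_le)
    with that d[of "(u, v)"] zero show ?thesis
      by (simp add: dist_norm)
  qed
  have "norm (a u v) \<le> norm u * norm v * (3 / d)\<^sup>2" for u v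
  proof (cases "u = 0 \<or> v = 0")
    case True
    then show ?thesis
      using linear_0[OF left, of v] linear_0[OF right, of u] by auto
  next
    case False
    \<comment> \<open>Rescaling both vectors to length \<open>d / 3\<close> brings them inside the
      range of \<open>unit\<close>; undoing it yields the constant \<open>(3 / d)^2\<close>.\<close>
    define r s where "r = d / (3 * norm u)" and "s = d / (3 * norm v)"
    have pos: "0 < r" "0 < s"
      unfolding r_def s_def using False \<open>0 < d\<close> by simp_all
    have "norm (r *\<^sub>R u) < d / 2" "norm (s *\<^sub>R v) < d / 2"
      unfolding r_def s_def using False \<open>0 < d\<close> by simp_all
    then have "norm (a (r *\<^sub>R u) (s *\<^sub>R v)) \<le> 1"
      by (rule unit)
    then have "r * s * norm (a u v) \<le> 1"
      using pos by (simp add: linear_scale[OF left] linear_scale[OF right] mult_ac)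
    then have "norm (a u v) \<le> 1 / (r * s)"
      using pos by (simp add: field_simps)
    also have "\<dots> = norm u * norm v * (3 / d)\<^sup>2"
      unfolding r_def s_def using False \<open>0 < d\<close> by (simp add: field_simps power2_eq_square)
    finally show ?thesis .
  qed
  then show "\<exists>K. \<forall>u v. norm (a u v) \<le> norm u * norm v * K"
    by blast
qed (simp_all add: linear_add[OF left] linear_add[OF right] linear_scale[OF left] linear_scale[OF right])

lemma cinner_scaleC_right: "cinner x (c *\<^sub>C y) = cnj c * cinner x y"
  by (metis cinner_commute cinner_scaleC_left complex_cnj_mult)

lemma sesquilinear_bounded_bilinear:
  fixes a :: "'v::complex_inner \<Rightarrow> 'v \<Rightarrow> complex"
  assumes "sesquilinear a" and "continuous_on UNIV (\<lambda>(u, v). a u v)"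
  shows "bounded_bilinear a"
  using assms
  by (intro continuous_bilinear_imp_bounded_bilinear linearI)
    (auto simp: sesquilinear_def scaleR_scaleC scaleC_complex_def)

lemma bounded_clinear_scaleC: "bounded_clinear j \<Longrightarrow> j (c *\<^sub>C u) = c *\<^sub>C j u"
  unfolding bounded_clinear_def by (auto simp: Vector_Spaces.linear_iff_module_hom module_hom.scale)

text \<open>Conjugate-linearity gives \<open>Re (f (\<i> v)) = Im (f v)\<close>. This lifts the real
  Lax-Milgram solution to an identity of complex forms.\<close>

lemma conjugate_linear_eqI:
  fixes f g :: "'v::complex_vector \<Rightarrow> complex"
  assumes "\<And>c v. f (c *\<^sub>C v) = cnj c * f v" "\<And>c v. g (c *\<^sub>C v) = cnj c * g v"
    and "\<And>v. Re (f v) = Re (g v)"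
  shows "f v = g v"
proof (rule complex_eqI)
  show "Im (f v) = Im (g v)"
    using assms(3)[of "\<i> *\<^sub>C v"] by (simp add: assms(1,2))
qed (rule assms(3))

text \<open>The real orthogonal complement of \<open>f\<close> is closed and contains a dense set,
  hence contains \<open>f\<close> itself.\<close>

lemma dense_range_cinner_eq_0:
  assumes "closure (range j) = UNIV" and "\<And>v. cinner f (j v) = 0"
  shows "f = 0"
proof -
  have "closed {y. inner f y = 0}"
    by (intro closed_Collect_eq continuous_intros)
  moreover have "range j \<subseteq> {y. inner f y = 0}"
    using assms(2) by (auto simp: inner_eq_Re_cinner)
  ultimately have "closure (range j) \<subseteq> {y. inner f y = 0}"
    by (simp add: closure_minimal)
  then have "inner f f = 0"
    using assms(1) by blast
  then show ?thesis by simp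
qed

section \<open>Sectorial operators\<close>

text \<open>In the open right half-plane \<open>|Arg z|\<close> is the arctangent of
  \<open>|Im z| / Re z\<close>; on the imaginary axis the bound leaves only
  \<open>z = 0\<close>.\<close>

lemma sectorI:
  assumes "\<bar>Im z\<bar> \<le> C * Re z" and "0 \<le> C" and "0 \<le> Re z"
  shows "z \<in> sector (arctan C)"
proof (cases "Re z = 0")
  case True
  then have "z = 0"
    using assms(1) by (simp add: complex_eq_iff)
  then show ?thesis
    unfolding sector_def using \<open>0 \<le> C\<close> by (intro CollectI exI[of _ 0]) auto
next
  case False
  then have pos: "0 < Re z"
    using assms(3) by simp
  have "\<bar>Arg z\<bar> \<le> arctan C"
  proof -
    have "\<bar>Im z / Re z\<bar> \<le> C"
      using pos assms(1) by (simp add: abs_divide field_simps)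
    moreover have "\<bar>Arg z\<bar> = arctan \<bar>Im z / Re z\<bar>"
      unfolding arg_conv_arctan[OF pos] by (auto simp: abs_if arctan_minus)
    ultimately show ?thesis
      by (simp add: arctan_monotone')
  qed
  moreover have "z = complex_of_real (norm z) * exp (\<i> * complex_of_real (Arg z))"
    using pos by (intro Arg_eq) auto
  ultimately show ?thesis
    unfolding sector_def by (intro CollectI exI[of _ "norm z"] exI[of _ "Arg z"]) simp
qed

text \<open>Subtracting two pairs with the same first entry reduces uniqueness of values to the
  fibre over 0.\<close>

lemma linear_operator_of_linear_relation:
  fixes R :: "'h::complex_vector \<Rightarrow> 'h \<Rightarrow> bool"
  assumes zero: "R 0 0"
    and add: "\<And>x y f g. R x f \<Longrightarrow> R y g \<Longrightarrow> R (x + y) (f + g)"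
    and scale: "\<And>c x f. R x f \<Longrightarrow> R (c *\<^sub>C x) (c *\<^sub>C f)"
    and single_valued: "\<And>f. R 0 f \<Longrightarrow> f = 0"
  shows "\<exists>A. linear_operator A \<and> (\<forall>x f. x \<in> dom A \<and> the (A x) = f \<longleftrightarrow> R x f)"
proof -
  have unique: "f = g" if "R x f" "R x g" for x f g
    using add[OF that(1) scale[OF that(2), of "- 1"]] single_valued[of "f - g"] by simp
  define A where "A x = (if \<exists>f. R x f then Some (THE f. R x f) else None)" for x
  have "(THE f. R x f) = f" if "R x f" for x f
    using that unique by blast
  then have graph: "x \<in> dom A \<and> the (A x) = f \<longleftrightarrow> R x f" for x f
    unfolding A_def by (auto split: if_splits)
  then have dom: "x \<in> dom A \<longleftrightarrow> R x (the (A x))" for x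
    by blast
  have "linear_operator A"
    unfolding linear_operator_def complex_vector.subspace_def
  proof (intro conjI ballI allI)
    show "0 \<in> dom A"
      using graph zero by blast
  next
    fix x y
    assume "x \<in> dom A" "y \<in> dom A"
    then have "R (x + y) (the (A x) + the (A y))"
      by (intro add) (simp_all flip: dom)
    then show "x + y \<in> dom A" "the (A (x + y)) = the (A x) + the (A y)"
      using graph by blast+
  next
    fix c x
    assume "x \<in> dom A"
    then have "R (c *\<^sub>C x) (c *\<^sub>C the (A x))"
      by (intro scale) (simp flip: dom)
    then show "c *\<^sub>C x \<in> dom A" "the (A (c *\<^sub>C x)) = c *\<^sub>C the (A x)"
      using graph by blast+
  qed
  with graph show ?thesis by blast
qed

section \<open>The operator associated with a form\<close>

lemma associated_operator_exists:
  fixes j :: "'v::complex_inner \<Rightarrow> 'h::complex_inner"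
  assumes j: "bounded_clinear j" and dense: "closure (range j) = UNIV"
    and a: "sesquilinear a" and ell: "j_elliptic j a"
  shows "\<exists>A. associated_operator a j A"
proof -
  interpret j: bounded_linear j
    using j by (simp add: bounded_clinear_def)
  define R where "R x f \<longleftrightarrow> (\<exists>u. j u = x \<and> (\<forall>v. a u v = cinner f (j v)))" for x f
  have a_add: "a (u + u') v = a u v + a u' v"
    and a_scale: "a (c *\<^sub>C u) v = c * a u v" for u u' v c
    using a by (simp_all add: sesquilinear_def)
  have "\<exists>A. linear_operator A \<and> (\<forall>x f. x \<in> dom A \<and> the (A x) = f \<longleftrightarrow> R x f)"
  proof (rule linear_operator_of_linear_relation)
    have "a 0 v = 0" "cinner 0 y = 0" for v and y :: 'h
      using a_add[of 0 0 v] cinner_add_left[of 0 0 y] by simp_all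
    then show "R 0 0"
      unfolding R_def using j.zero by (intro exI[of _ 0]) simp
  next
    show "R (x + y) (f + g)" if "R x f" "R y g" for x y f g
      using that unfolding R_def by (metis a_add cinner_add_left j.add)
  next
    show "R (c *\<^sub>C x) (c *\<^sub>C f)" if "R x f" for c x f
      using that unfolding R_def by (metis a_scale cinner_scaleC_left bounded_clinear_scaleC[OF j])
  next
    fix f
    assume "R 0 f"
    then obtain u where u: "j u = 0" "\<And>v. a u v = cinner f (j v)"
      unfolding R_def by blast
    obtain \<omega> \<mu> where "0 < \<mu>" and \<mu>: "\<mu> * (norm u)\<^sup>2 \<le> Re (a u u) + \<omega> * (norm (j u))\<^sup>2"
      using ell unfolding j_elliptic_def by blast
    \<comment> \<open>Testing with \<open>v = u\<close> gives \<open>a u u = cinner f (j u)\<close>,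
      which vanishes because \<open>j u = 0\<close>; the \<omega> term of ellipticity vanishes
      too.\<close>
    have "Re (a u u) = 0"
      by (simp add: u flip: inner_eq_Re_cinner)
    with \<mu> have "\<mu> * (norm u)\<^sup>2 \<le> 0"
      by (simp add: u(1))
    with \<open>0 < \<mu>\<close> have "u = 0"
      by (simp add: mult_le_0_iff)
    then have "cinner f (j v) = 0" for v
      using a_add[of 0 0 v] by (simp flip: u(2))
    then show "f = 0"
      using dense dense_range_cinner_eq_0 by blast
  qed
  then show ?thesis
    unfolding associated_operator_def R_def by blast
qed

text \<open>Sectoriality starts from \<open>x\<close> in the domain and picks a witness
  \<open>u\<close>; surjectivity goes the other way, solving for \<open>u\<close> first and then
  taking \<open>x = j u\<close>.\<close>

lemma associated_operator_m_sectorial: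
  fixes j :: "'v::complex_hilbert \<Rightarrow> 'h::complex_inner"
  assumes j: "bounded_clinear j"
    and a: "sesquilinear a" and cont: "continuous_on UNIV (\<lambda>(u, v). a u v)"
    and ell: "j_elliptic j a" and A: "associated_operator a j A"
  shows "m_sectorial A"
proof -
  interpret j: bounded_linear j
    using j by (simp add: bounded_clinear_def)
  interpret a: bounded_bilinear a
    using a cont by (rule sesquilinear_bounded_bilinear)
  have graph: "x \<in> dom A \<and> the (A x) = f \<longleftrightarrow> (\<exists>u. j u = x \<and> (\<forall>v. a u v = cinner f (j v)))" for x f
    using A by (simp add: associated_operator_def)
  obtain \<omega> \<mu> where "0 < \<mu>" and elliptic: "\<And>u. \<mu> * (norm u)\<^sup>2 \<le> Re (a u u) + \<omega> * (norm (j u))\<^sup>2"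
    using ell unfolding j_elliptic_def by blast
  obtain M where "0 < M" and M: "\<And>u v. norm (a u v) \<le> norm u * norm v * M"
    using a.pos_bounded by blast
  have "sectorial_with A (- \<omega>) (arctan (M / \<mu>))"
    unfolding sectorial_with_def
  proof (intro conjI ballI)
    show "0 \<le> arctan (M / \<mu>)"
      using \<open>0 < M\<close> \<open>0 < \<mu>\<close> by simp
    show "arctan (M / \<mu>) < pi / 2"
      by (rule arctan_ubound)
  next
    fix x
    assume "x \<in> dom A"
    then obtain u where u: "j u = x" "\<And>v. a u v = cinner (the (A x)) (j v)"
      using graph by blast
    \<comment> \<open>The shift is real, so \<open>Im z = Im (a u u)\<close> is bounded by
      \<open>M |u|^2\<close>, while ellipticity gives \<open>Re z \<ge> \<mu> |u|^2\<close>. The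
      quotient of the constants is the slope \<open>M / \<mu>\<close> of the sector.\<close>
    define z where "z = cinner (the (A x)) x - complex_of_real (- \<omega> * (norm x)\<^sup>2)"
    have z: "z = a u u + complex_of_real (\<omega> * (norm (j u))\<^sup>2)"
      unfolding z_def using u by simp
    have "\<mu> * (norm u)\<^sup>2 \<le> Re z"
      using elliptic[of u] by (simp add: z)
    then have "(norm u)\<^sup>2 * M \<le> M / \<mu> * Re z"
      using \<open>0 < \<mu>\<close> \<open>0 < M\<close> by (simp add: field_simps)
    moreover have "\<bar>Im z\<bar> \<le> (norm u)\<^sup>2 * M"
      using abs_Im_le_cmod[of "a u u"] M[of u u] by (simp add: z power2_eq_square)
    moreover have "0 \<le> Re z"
      using \<open>\<mu> * (norm u)\<^sup>2 \<le> Re z\<close> \<open>0 < \<mu>\<close> by (meson mult_nonneg_nonneg less_imp_le order_trans zero_le_power2)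
    ultimately show "cinner (the (A x)) x - complex_of_real (- \<omega> * (norm x)\<^sup>2) \<in> sector (arctan (M / \<mu>))"
      unfolding z_def[symmetric] using \<open>0 < M\<close> \<open>0 < \<mu>\<close> by (intro sectorI) simp_all
  qed
  moreover have "(\<lambda>x. (- \<omega> - 1) *\<^sub>R x - the (A x)) ` dom A = UNIV"
  proof -
    \<comment> \<open>The real part of \<open>a(u, v) - \<nu> (j u, j v)\<close> with
      \<open>\<nu> = - \<omega> - 1\<close>. Ellipticity absorbs the \<omega> part, and the
      remaining \<open>|j u|^2\<close> is nonnegative.\<close>
    define B where "B u v = Re (a u v) + (\<omega> + 1) * inner (j u) (j v)" for u v
    have "bounded_bilinear B"
    proof (rule continuous_bilinear_imp_bounded_bilinear)
      show "linear (\<lambda>u. B u v)" for v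
        unfolding B_def
        by (intro linearI) (simp_all add: a.add_left a.scaleR_left j.add j.scaleR inner_add_left algebra_simps)
      show "linear (B u)" for u
        unfolding B_def
        by (intro linearI) (simp_all add: a.add_right a.scaleR_right j.add j.scaleR inner_add_right algebra_simps)
      show "continuous_on UNIV (\<lambda>(u, v). B u v)"
        unfolding B_def case_prod_unfold
        by (intro continuous_intros a.continuous_on j.continuous_on)
    qed
    have "\<mu> * (norm u)\<^sup>2 \<le> B u u" for u
    proof -
      have "B u u = Re (a u u) + \<omega> * (norm (j u))\<^sup>2 + (norm (j u))\<^sup>2"
        unfolding B_def by (simp add: power2_norm_eq_inner algebra_simps)
      with elliptic[of u] show ?thesis
        by (simp add: add_increasing2)
    qed
    have "g \<in> (\<lambda>x. (- \<omega> - 1) *\<^sub>R x - the (A x)) ` dom A" for g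
    proof -
      \<comment> \<open>The sign comes from pairing \<open>\<nu> x - A x = g\<close> with
        \<open>j v\<close>: the shifted form must equal \<open>- (g, j v)\<close>.\<close>
      have "bounded_linear (\<lambda>v. - inner g (j v))"
        by (intro bounded_linear_minus bounded_linear_compose[OF bounded_linear_inner_right]
            j.bounded_linear_axioms)
      then obtain u where u: "\<And>v. B u v = - inner g (j v)"
        using lax_milgram \<open>bounded_bilinear B\<close> \<open>0 < \<mu>\<close> \<open>\<And>u. \<mu> * (norm u)\<^sup>2 \<le> B u u\<close> by metis
      \<comment> \<open>The value at \<open>j u\<close> that the equation
        \<open>\<nu> x - A x = g\<close> prescribes.\<close>
      define f where "f = (- \<omega> - 1) *\<^sub>R j u - g"
      have "a u v = cinner f (j v)" for v
      proof (rule conjugate_linear_eqI[of "a u" "\<lambda>v. cinner f (j v)"])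
        show "a u (c *\<^sub>C v) = cnj c * a u v" for c v
          using a by (simp add: sesquilinear_def)
        show "cinner f (j (c *\<^sub>C v)) = cnj c * cinner f (j v)" for c v
          by (simp add: bounded_clinear_scaleC[OF j] cinner_scaleC_right)
        show "Re (a u v) = Re (cinner f (j v))" for v
          using u[of v] unfolding B_def f_def inner_eq_Re_cinner[symmetric]
          by (simp add: inner_diff_left algebra_simps)
      qed
      then have "j u \<in> dom A" "the (A (j u)) = f"
        using graph by blast+
      then show ?thesis
        unfolding f_def by (intro image_eqI[of _ _ "j u"]) simp_all
    qed
    then show ?thesis by blast
  qed
  ultimately show ?thesis
    unfolding m_sectorial_def by (intro exI conjI[rotated]) auto
qed

theorem theorem2p1:
  fixes j :: "'v::complex_hilbert \<Rightarrow> 'h::complex_hilbert"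
    and a :: "'v \<Rightarrow> 'v \<Rightarrow> complex"
  assumes "bounded_clinear j"
    and "closure (range j) = UNIV"
    and "sesquilinear a"
    and "continuous_on UNIV (\<lambda>(u, v). a u v)"
    and "j_elliptic j a"
  shows "(\<exists>A. associated_operator a j A) \<and>
         (\<forall>A. associated_operator a j A \<longrightarrow> m_sectorial A)"
  using associated_operator_exists associated_operator_m_sectorial assms by blast

end
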